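(* Let $L_2=D^2+c_{1,0}D+c_{0,0}+c_{0,1}x$ with $c_{1,0},c_{0,0},c_{0,1}\in\mathbb R$, $c_{0,1}\ne0$. On any domain of $(t,s)\in\mathbb R^2$ on which $1-c_{0,1}s\neq0$, the first two Heat--Airy compatibility equations for $L_2$, namely $$2(1-c_{0,1}s)f_t=c_{1,0}+c_{0,1}t$$ and $$3(1-c_{0,1}s)f_s-2(c_{1,0}+c_{0,1}t)f_t+c_{0,0}+c_{0,1}f=0 ,$$ admit the family of solutions $$f(t,s)=-\frac{c_{0,0}}{c_{0,1}}+C(1-c_{0,1}s)^{1/3}+\frac{(c_{1,0}+c_{0,1}t)^2}{4c_{0,1}(1-c_{0,1}s)} ,\qquad C\in\mathbb R .$$
   Context: $D=\partial/\partial x$, and $y^{1/3}$ is the real cube root. The Heat--Airy transport of $L_2$, obtained by replacing $x$ by $x+tD-sD^2$, is $N_2=(c_{0,0}+c_{0,1}x)+(c_{1,0}+c_{0,1}t)D+(1-c_{0,1}s)D^2$. For $v$ with $v_t=\frac12v_{xx}$, $v_s=-\frac13v_{xxx}$, $N_2v=0$ and $v(t,s,f(t,s))=0$, $v_x(t,s,f(t,s))\neq0$, the first and second compatibility equations are the restrictions of $N_2v=0$ and $D(N_2v)=0$ to $x=f(t,s)$, rewritten using $v=0$, $v_{xx}=-2f_tv_x$, $v_{xxx}=3f_sv_x$ on the boundary and divided by $v_x$; their explicit forms are those in the claim. *)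

theory Defs
  imports "HOL-Analysis.Analysis"
begin

definition dt :: "(real \<Rightarrow> real \<Rightarrow> real) \<Rightarrow> real \<Rightarrow> real \<Rightarrow> real"
  where "dt f t s = deriv (\<lambda>\<tau>. f \<tau> s) t"

definition ds :: "(real \<Rightarrow> real \<Rightarrow> real) \<Rightarrow> real \<Rightarrow> real \<Rightarrow> real"
  where "ds f t s = deriv (\<lambda>\<sigma>. f t \<sigma>) s"

text \<open>The operator D^2 + c10 D + c00 + c01 x acting on functions of x, with the operator
  Q in place of multiplication by x, so that substitutions for x can be expressed: Q = x gives L2, and Q = x + tD - sD^2 gives
  its Heat-Airy transport N2.\<close>

definition L2_subst ::
  "real \<Rightarrow> real \<Rightarrow> real \<Rightarrow> ((real \<Rightarrow> real) \<Rightarrow> real \<Rightarrow> real) \<Rightarrow> (real \<Rightarrow> real) \<Rightarrow> real \<Rightarrow> real"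
  where "L2_subst c10 c00 c01 Q v x =
    (deriv ^^ 2) v x + c10 * deriv v x + c00 * v x + c01 * Q v x"

definition L2 :: "real \<Rightarrow> real \<Rightarrow> real \<Rightarrow> (real \<Rightarrow> real) \<Rightarrow> real \<Rightarrow> real"
  where "L2 c10 c00 c01 = L2_subst c10 c00 c01 (\<lambda>v x. x * v x)"

definition N2 :: "real \<Rightarrow> real \<Rightarrow> real \<Rightarrow> real \<Rightarrow> real \<Rightarrow> (real \<Rightarrow> real) \<Rightarrow> real \<Rightarrow> real"
  where "N2 c10 c00 c01 t s =
    L2_subst c10 c00 c01 (\<lambda>v x. x * v x + t * deriv v x - s * (deriv ^^ 2) v x)"

lemma N2_explicit:
  "N2 c10 c00 c01 t s v x =
     (c00 + c01 * x) * v x + (c10 + c01 * t) * deriv v x + (1 - c01 * s) * (deriv ^^ 2) v x"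
  by (simp add: N2_def L2_subst_def algebra_simps)

text \<open>The relations v = 0, v_x \<noteq> 0, v_xx = -2 f_t v_x, v_xxx = 3 f_s v_x at the boundary
  point y = f(t,s), where p and q stand for f_t and f_s, and v is the function of x at fixed (t,s).
  The lemma after the definition shows that the last two relations follow from the evolution
  equations for v and v(t,s,f(t,s)) = 0.\<close>

definition boundary_jet :: "real \<Rightarrow> real \<Rightarrow> real \<Rightarrow> (real \<Rightarrow> real) \<Rightarrow> bool"
  where "boundary_jet y p q v \<longleftrightarrow>
    (\<forall>k x. (deriv ^^ k) v differentiable (at x)) \<and>
    v y = 0 \<and> deriv v y \<noteq> 0 \<and>
    (deriv ^^ 2) v y = - 2 * p * deriv v y \<and>
    (deriv ^^ 3) v y = 3 * q * deriv v y"

lemma boundary_relations: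
  fixes v :: "real \<Rightarrow> real \<Rightarrow> real \<Rightarrow> real" and f :: "real \<Rightarrow> real \<Rightarrow> real"
  assumes "open \<Omega>" and "(t, s) \<in> \<Omega>"
    and f_diff: "(\<lambda>(t, s). f t s) differentiable (at (t, s))"
    and v_diff: "(\<lambda>(t, s, x). v t s x) differentiable (at (t, s, f t s))"
    and zero: "\<And>t s. (t, s) \<in> \<Omega> \<Longrightarrow> v t s (f t s) = 0"
    and v_t: "deriv (\<lambda>\<tau>. v \<tau> s (f t s)) t = 1/2 * (deriv ^^ 2) (v t s) (f t s)"
    and v_s: "deriv (\<lambda>\<sigma>. v t \<sigma> (f t s)) s = - (1/3) * (deriv ^^ 3) (v t s) (f t s)"
  shows "(deriv ^^ 2) (v t s) (f t s) = - 2 * dt f t s * deriv (v t s) (f t s)"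
    and "(deriv ^^ 3) (v t s) (f t s) = 3 * ds f t s * deriv (v t s) (f t s)"
proof -
  let ?y = "f t s"
  obtain F where F: "((\<lambda>(t, s). f t s) has_derivative F) (at (t, s))"
    using f_diff unfolding differentiable_def by blast
  obtain V where V: "((\<lambda>(t, s, x). v t s x) has_derivative V) (at (t, s, ?y))"
    using v_diff unfolding differentiable_def by blast
  have linF: "linear F" and linV: "linear V"
    using F V has_derivative_linear by blast+
  have line: "((\<lambda>r. f (t + r * a) (s + r * b)) has_real_derivative F (a, b)) (at 0)" for a b
  proof -
    have "((\<lambda>r. (t + r * a, s + r * b)) has_derivative (\<lambda>h. h *\<^sub>R (a, b))) (at 0)"
      by (auto intro!: derivative_eq_intros)
    from has_derivative_compose[OF this, of "\<lambda>(t, s). f t s" F] F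
    have "((\<lambda>r. f (t + r * a) (s + r * b)) has_derivative (\<lambda>h. F (h *\<^sub>R (a, b)))) (at 0)"
      by simp
    then show ?thesis
      using linF by (simp add: has_field_derivative_def linear_scale mult.commute[of _ "F _"]
          del: scaleR_Pair)
  qed
  have curve: "((\<lambda>r. v (t + r * a) (s + r * b) (g r)) has_real_derivative V (a, b, c)) (at 0)"
    if g: "(g has_real_derivative c) (at 0)" "g 0 = ?y" for a b c g
  proof -
    have "((\<lambda>r. (t + r * a, s + r * b, g r)) has_derivative (\<lambda>h. h *\<^sub>R (a, b, c))) (at 0)"
      using g(1) unfolding has_field_derivative_def
      by (auto intro!: derivative_eq_intros simp: mult.commute)
    from has_derivative_compose[OF this, of "\<lambda>(t, s, x). v t s x" V] V g(2)
    have "((\<lambda>r. v (t + r * a) (s + r * b) (g r)) has_derivative (\<lambda>h. V (h *\<^sub>R (a, b, c)))) (at 0)"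
      by simp
    then show ?thesis
      using linV by (simp add: has_field_derivative_def linear_scale mult.commute[of _ "V _"]
          del: scaleR_Pair)
  qed
  have shift: "deriv h z = d" if "((\<lambda>r. h (z + r)) has_real_derivative d) (at 0)"
    for h :: "real \<Rightarrow> real" and z d
    using that DERIV_at_within_shift[of h d z 0 UNIV] by (simp add: DERIV_imp_deriv)
  have Ft: "dt f t s = F (1, 0)" and Fs: "ds f t s = F (0, 1)"
    using line[of 1 0] line[of 0 1] unfolding dt_def ds_def by (auto intro: shift)
  have Vt: "deriv (\<lambda>\<tau>. v \<tau> s ?y) t = V (1, 0, 0)"
    using curve[of "\<lambda>_. ?y" 0 1 0] by (intro shift) auto
  have Vs: "deriv (\<lambda>\<sigma>. v t \<sigma> ?y) s = V (0, 1, 0)"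
    using curve[of "\<lambda>_. ?y" 0 0 1] by (intro shift) auto
  have Vx: "deriv (v t s) ?y = V (0, 0, 1)"
    proof -
    have "((\<lambda>r. ?y + r) has_real_derivative 1) (at 0)"
      by (auto intro!: derivative_eq_intros)
    from curve[OF this, of 0 0] show ?thesis
      by (intro shift) simp
  qed
  have tangent: "V (a, b, F (a, b)) = 0" for a b
  proof -
    have "((\<lambda>r. (t + r * a, s + r * b)) \<longlongrightarrow> (t, s)) (at 0)"
      by (auto intro!: tendsto_eq_intros)
    then have "\<forall>\<^sub>F r in at 0. (t + r * a, s + r * b) \<in> \<Omega>"
      using assms(1,2) topological_tendstoD by blast
    then have "\<forall>\<^sub>F r in at 0. v (t + r * a) (s + r * b) (f (t + r * a) (s + r * b)) = 0"
      by eventually_elim (rule zero)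
    then have "\<forall>\<^sub>F r in nhds 0. v (t + r * a) (s + r * b) (f (t + r * a) (s + r * b)) = 0"
      using zero[OF assms(2)] by (auto simp: eventually_at_filter elim: eventually_mono)
    then have "((\<lambda>r. v (t + r * a) (s + r * b) (f (t + r * a) (s + r * b)))
        has_real_derivative 0) (at 0)"
      by (subst DERIV_cong_ev[OF refl _ refl, where g = "\<lambda>_. 0"]) auto
    with curve[OF line, of a b a b] show ?thesis
      using DERIV_unique by simp blast
  qed
  have V_split: "V (a, b, c) = V (a, b, 0) + c * V (0, 0, 1)" for a b c
    using linear_add[OF linV, of "(a, b, 0)" "(0, 0, c)"]
      linear_scale[OF linV, of c "(0, 0, 1)"] by simp
  show "(deriv ^^ 2) (v t s) ?y = - 2 * dt f t s * deriv (v t s) ?y"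
    using tangent[of 1 0] V_split[of 1 0 "F (1, 0)"] v_t Vt Ft Vx by simp
  show "(deriv ^^ 3) (v t s) ?y = 3 * ds f t s * deriv (v t s) ?y"
    using tangent[of 0 1] V_split[of 0 1 "F (0, 1)"] v_s Vs Fs Vx by simp
qed

text \<open>The restriction of D^k (N2 v) = 0 to x = f(t,s), rewritten by the boundary relations and
  divided by v_x. It constrains f only through f, f_t and f_s at (t,s): here v is an arbitrary smooth
  function with the prescribed boundary values and is not itself assumed to satisfy N2 v = 0.
  The first and second compatibility equations are those for k = 0 and k = 1.\<close>

definition compatibility_eq ::
  "real \<Rightarrow> real \<Rightarrow> real \<Rightarrow> nat \<Rightarrow> (real \<Rightarrow> real \<Rightarrow> real) \<Rightarrow> real \<Rightarrow> real \<Rightarrow> bool"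
  where "compatibility_eq c10 c00 c01 k f t s \<longleftrightarrow>
    (\<forall>v. boundary_jet (f t s) (dt f t s) (ds f t s) v \<longrightarrow>
      (deriv ^^ k) (N2 c10 c00 c01 t s v) (f t s) / deriv v (f t s) = 0)"

definition compatibility_solution_on ::
  "real \<Rightarrow> real \<Rightarrow> real \<Rightarrow> (real \<times> real) set \<Rightarrow> (real \<Rightarrow> real \<Rightarrow> real) \<Rightarrow> bool"
  where "compatibility_solution_on c10 c00 c01 \<Omega> f \<longleftrightarrow>
    (\<lambda>(t, s). f t s) differentiable_on \<Omega> \<and>
    (\<forall>(t, s)\<in>\<Omega>. compatibility_eq c10 c00 c01 0 f t s \<and> compatibility_eq c10 c00 c01 1 f t s)"

end

theory Submission
  imports Defs
begin

text \<open>Dividing N2 v and D (N2 v) at the boundary by v_x leaves expressions in f, f_t and f_s only.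
  Since the compatibility equations quantify over all v with the boundary jet, recovering the
  explicit equations from them needs one such v; the cubic X - p X^2 + (q/2) X^3 with X = x - y
  serves. The stated family is then checked by differentiation, where the
  terms in C cancel because B (d/ds) B^(1/3) = -(c01/3) B^(1/3) for B = 1 - c01 s.\<close>

lemma funpow_deriv_poly:
  fixes p :: "real poly"
  shows "(deriv ^^ k) (poly p) = poly ((pderiv ^^ k) p)"
proof (induction k)
  case (Suc k)
  have "deriv (poly q) = poly (pderiv q)" for q :: "real poly"
    by (rule ext) (simp add: DERIV_imp_deriv poly_DERIV)
  with Suc show ?case
    by simp
qed simp

lemma boundary_jet_exists: "\<exists>v. boundary_jet y p q v"
proof -
  \<comment> \<open>The coefficients are the Taylor coefficients of the prescribed jet: the
    derivatives 0, 1, -2p, 3q divided by 0!, 1!, 2!, 3!.\<close>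
  define P where "P = [:0, 1, - p, q / 2:]"
  define S where "S = [:- y, 1:]"
  \<comment> \<open>\<open>S\<close> is the translation x - y, whose derivative is 1, so it commutes
    with differentiation and moves the jet of \<open>P\<close> from 0 to y.\<close>
  have "pderiv (pcompose R S) = pcompose (pderiv R) S" for R
    by (simp add: S_def pderiv_pcompose pderiv_pCons)
  then have shift: "(pderiv ^^ k) (pcompose P S) = pcompose ((pderiv ^^ k) P) S" for k
    by (induction k) auto
  have jet: "(deriv ^^ k) (poly (pcompose P S)) y = poly ((pderiv ^^ k) P) 0" for k
    unfolding funpow_deriv_poly shift by (simp add: poly_pcompose S_def)
  have "(deriv ^^ k) (poly (pcompose P S)) differentiable (at x)" for k x
    unfolding funpow_deriv_poly real_differentiable_def using poly_DERIV by blast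
  then have "boundary_jet y p q (poly (pcompose P S))"
    using jet[of 0] jet[of 1] jet[of 2] jet[of 3]
    unfolding boundary_jet_def
    by (simp add: P_def pderiv_pCons numeral_eq_Suc)
  then show ?thesis
    by blast
qed

text \<open>On the jet the term without derivatives vanishes and v_xx / v_x = -2 f_t, so the
  quotient takes the same value for every admissible v. The quantifier over v then collapses; the
  forward direction rests on \<open>boundary_jet_exists\<close>.\<close>

lemma compatibility_eq_0_iff:
  "compatibility_eq c10 c00 c01 0 f t s \<longleftrightarrow>
     2 * (1 - c01 * s) * dt f t s = c10 + c01 * t"
proof -
  let ?jet = "boundary_jet (f t s) (dt f t s) (ds f t s)"
  have "N2 c10 c00 c01 t s v (f t s) / deriv v (f t s)
      = c10 + c01 * t - 2 * (1 - c01 * s) * dt f t s" if "?jet v" for v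
    using that unfolding boundary_jet_def N2_explicit by (simp add: field_simps)
  then show ?thesis
    using boundary_jet_exists[of "f t s" "dt f t s" "ds f t s"]
    unfolding compatibility_eq_def by auto
qed

lemma deriv_N2:
  assumes "\<And>k x. (deriv ^^ k) v differentiable (at x)"
  shows "deriv (N2 c10 c00 c01 t s v) x =
    c01 * v x + (c00 + c01 * x) * deriv v x + (c10 + c01 * t) * (deriv ^^ 2) v x
      + (1 - c01 * s) * (deriv ^^ 3) v x"
proof -
  \<comment> \<open>\<open>deriv\<close> is total, so it is smoothness that makes each iterate the
    true derivative of the one before.\<close>
  have step: "((deriv ^^ k) v has_real_derivative (deriv ^^ Suc k) v x) (at x)" for k
    using assms[of k x] by (simp add: DERIV_deriv_iff_real_differentiable)
  have "(N2 c10 c00 c01 t s v has_real_derivative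
    c01 * v x + (c00 + c01 * x) * deriv v x + (c10 + c01 * t) * (deriv ^^ 2) v x
      + (1 - c01 * s) * (deriv ^^ 3) v x) (at x)"
    unfolding N2_explicit[abs_def]
    using step[of 0] step[of 1] step[of 2]
    by (auto intro!: derivative_eq_intros simp: numeral_eq_Suc algebra_simps)
  then show ?thesis
    by (rule DERIV_imp_deriv)
qed

lemma compatibility_eq_1_iff:
  "compatibility_eq c10 c00 c01 1 f t s \<longleftrightarrow>
     3 * (1 - c01 * s) * ds f t s - 2 * (c10 + c01 * t) * dt f t s + c00 + c01 * f t s = 0"
proof -
  let ?jet = "boundary_jet (f t s) (dt f t s) (ds f t s)"
  have "deriv (N2 c10 c00 c01 t s v) (f t s) / deriv v (f t s)
      = 3 * (1 - c01 * s) * ds f t s - 2 * (c10 + c01 * t) * dt f t s + c00 + c01 * f t s"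
    if "?jet v" for v
  proof -
    \<comment> \<open>The term \<open>c01 * v x\<close>, which comes from differentiating the
      coefficient x, vanishes at the boundary; all other terms are multiples of v_x there.\<close>
    have "deriv (N2 c10 c00 c01 t s v) (f t s) =
      (3 * (1 - c01 * s) * ds f t s - 2 * (c10 + c01 * t) * dt f t s + c00 + c01 * f t s)
        * deriv v (f t s)"
      using that unfolding boundary_jet_def by (simp add: deriv_N2 algebra_simps)
    then show ?thesis
      using that unfolding boundary_jet_def by simp
  qed
  then show ?thesis
    using boundary_jet_exists[of "f t s" "dt f t s" "ds f t s"]
    unfolding compatibility_eq_def by auto
qed

text \<open>The constant absorbs c00 in the second equation, the quadratic term integrates the first
  equation in t, and the C-term solves the homogeneous parts of both.\<close>

definition airy_boundary :: "real \<Rightarrow> real \<Rightarrow> real \<Rightarrow> real \<Rightarrow> real \<Rightarrow> real \<Rightarrow> real"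
  where "airy_boundary c10 c00 c01 C t s =
    - (c00 / c01) + C * root 3 (1 - c01 * s) + (c10 + c01 * t)\<^sup>2 / (4 * c01 * (1 - c01 * s))"

lemma dt_airy_boundary:
  assumes "c01 \<noteq> 0" "1 - c01 * s \<noteq> 0"
  shows "dt (airy_boundary c10 c00 c01 C) t s = (c10 + c01 * t) / (2 * (1 - c01 * s))"
  unfolding dt_def airy_boundary_def
proof (rule DERIV_imp_deriv)
  show "((\<lambda>t. - (c00 / c01) + C * root 3 (1 - c01 * s)
      + (c10 + c01 * t)\<^sup>2 / (4 * c01 * (1 - c01 * s)))
    has_real_derivative (c10 + c01 * t) / (2 * (1 - c01 * s))) (at t)"
    using assms
    by (auto intro!: derivative_eq_intros simp: divide_simps) (simp add: algebra_simps)
qed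

lemma ds_airy_boundary:
  assumes "c01 \<noteq> 0" "1 - c01 * s \<noteq> 0"
  shows "ds (airy_boundary c10 c00 c01 C) t s =
    - (C * c01 * root 3 (1 - c01 * s)) / (3 * (1 - c01 * s))
      + (c10 + c01 * t)\<^sup>2 / (4 * (1 - c01 * s)\<^sup>2)"
  unfolding ds_def airy_boundary_def
proof (rule DERIV_imp_deriv)
  define B where "B = 1 - c01 * s"
  have B: "B \<noteq> 0" and inner: "((\<lambda>s. 1 - c01 * s) has_real_derivative - c01) (at s)"
    using assms by (auto simp: B_def intro!: derivative_eq_intros)
  \<comment> \<open>With B = r^3 the derivative 1/(3 r^2) of the cube root becomes r/(3B), which is
    linear in the root itself.\<close>
  define r where "r = root 3 B"
  have r: "r \<noteq> 0" and B_r: "B = r ^ 3"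
    using B by (simp_all add: r_def odd_real_root_pow)
  \<comment> \<open>The odd root is differentiable at every nonzero point, so B may have either
    sign.\<close>
  have "(root 3 has_real_derivative inverse (3 * r ^ 2)) (at (1 - c01 * s))"
    using DERIV_odd_real_root[of 3 B] B by (simp add: r_def B_def power2_eq_square)
  from DERIV_chain2[OF this inner]
  have root: "((\<lambda>s. root 3 (1 - c01 * s)) has_real_derivative - (c01 * r) / (3 * B)) (at s)"
    using r by (simp add: B_r field_simps power2_eq_square power3_eq_cube)
  have quotient: "((\<lambda>s. (c10 + c01 * t)\<^sup>2 / (4 * c01 * (1 - c01 * s)))
      has_real_derivative (c10 + c01 * t)\<^sup>2 / (4 * B\<^sup>2)) (at s)"
    using assms B unfolding B_def
    by (auto intro!: derivative_eq_intros simp: divide_simps power2_eq_square)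
      (simp add: algebra_simps)
  show "((\<lambda>s. - (c00 / c01) + C * root 3 (1 - c01 * s)
      + (c10 + c01 * t)\<^sup>2 / (4 * c01 * (1 - c01 * s))) has_real_derivative
    - (C * c01 * root 3 (1 - c01 * s)) / (3 * (1 - c01 * s))
      + (c10 + c01 * t)\<^sup>2 / (4 * (1 - c01 * s)\<^sup>2)) (at s)"
    using DERIV_add[OF DERIV_add[OF DERIV_const[of "- (c00 / c01)"] DERIV_cmult[OF root, of C]]
        quotient]
    by (simp add: r_def B_def mult.assoc)
qed

text \<open>\<open>compatibility_solution_on\<close> demands joint differentiability in (t, s),
  which the partial derivatives found above do not by themselves provide.\<close>

lemma airy_boundary_differentiable:
  assumes "c01 \<noteq> 0" "1 - c01 * s \<noteq> 0"
  shows "(\<lambda>(t, s). airy_boundary c10 c00 c01 C t s) differentiable (at (t, s))"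
proof -
  have "root 3 differentiable (at (1 - c01 * snd (t, s)))"
    using DERIV_odd_real_root[of 3 "1 - c01 * s"] assms
    by (auto simp: real_differentiable_def)
  then have "(\<lambda>z. root 3 (1 - c01 * snd z)) differentiable (at (t, s))"
    by (rule differentiable_compose)
      (auto simp: differentiable_def intro!: exI derivative_eq_intros)
  moreover have "(\<lambda>z. (c10 + c01 * fst z)\<^sup>2 / (4 * c01 * (1 - c01 * snd z)))
      differentiable (at (t, s))"
    using assms unfolding differentiable_def
    by (fastforce intro!: derivative_eq_intros)
  ultimately show ?thesis
    unfolding airy_boundary_def case_prod_unfold
    by (intro differentiable_add differentiable_mult differentiable_const)
qed

lemma airy_boundary_equations:
  fixes c10 c00 c01 C :: real
  assumes "c01 \<noteq> 0" "1 - c01 * s \<noteq> 0"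
  defines "f \<equiv> airy_boundary c10 c00 c01 C"
  shows "2 * (1 - c01 * s) * dt f t s = c10 + c01 * t"
    and "3 * (1 - c01 * s) * ds f t s - 2 * (c10 + c01 * t) * dt f t s + c00 + c01 * f t s = 0"
proof -
  show "2 * (1 - c01 * s) * dt f t s = c10 + c01 * t"
    using assms by (simp add: dt_airy_boundary)
  define A B r where "A = c10 + c01 * t" and "B = 1 - c01 * s" and "r = root 3 B"
  have "B \<noteq> 0"
    using assms by (simp add: B_def)
  have derivs: "dt f t s = A / (2 * B)" "ds f t s = - (C * c01 * r) / (3 * B) + A\<^sup>2 / (4 * B\<^sup>2)"
    "f t s = - (c00 / c01) + C * r + A\<^sup>2 / (4 * c01 * B)"
    using assms
    by (simp_all add: dt_airy_boundary ds_airy_boundary airy_boundary_def A_def B_def r_def)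
  \<comment> \<open>Besides the C-terms, c00 cancels against the constant, and the multiples of
    A^2/B sum to 3/4 - 1 + 1/4 = 0.\<close>
  have "3 * B * ds f t s - 2 * A * dt f t s + c00 + c01 * f t s = 0"
    unfolding derivs using \<open>c01 \<noteq> 0\<close> \<open>B \<noteq> 0\<close>
    by (simp add: field_simps power2_eq_square)
  then show "3 * (1 - c01 * s) * ds f t s - 2 * (c10 + c01 * t) * dt f t s + c00 + c01 * f t s = 0"
    by (simp add: A_def B_def)
qed

theorem proposition6p1:
  fixes c10 c00 c01 :: real and \<Omega> :: "(real \<times> real) set"
  assumes "c01 \<noteq> 0"
    and "open \<Omega>" and "connected \<Omega>"
    and "\<forall>(t, s)\<in>\<Omega>. 1 - c01 * s \<noteq> 0"
  shows "(\<forall>f. \<forall>(t, s)\<in>\<Omega>.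
            (compatibility_eq c10 c00 c01 0 f t s \<longleftrightarrow>
               2 * (1 - c01 * s) * dt f t s = c10 + c01 * t) \<and>
            (compatibility_eq c10 c00 c01 1 f t s \<longleftrightarrow>
               3 * (1 - c01 * s) * ds f t s - 2 * (c10 + c01 * t) * dt f t s
                 + c00 + c01 * f t s = 0)) \<and>
         (\<forall>C::real. compatibility_solution_on c10 c00 c01 \<Omega>
            (\<lambda>t s. - (c00 / c01) + C * root 3 (1 - c01 * s)
                   + (c10 + c01 * t)\<^sup>2 / (4 * c01 * (1 - c01 * s))))"
proof (intro conjI allI)
  show "\<forall>(t, s)\<in>\<Omega>.
      (compatibility_eq c10 c00 c01 0 f t s \<longleftrightarrow>
         2 * (1 - c01 * s) * dt f t s = c10 + c01 * t) \<and>
      (compatibility_eq c10 c00 c01 1 f t s \<longleftrightarrow>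
         3 * (1 - c01 * s) * ds f t s - 2 * (c10 + c01 * t) * dt f t s
           + c00 + c01 * f t s = 0)" for f
    \<comment> \<open>Both equivalences are pointwise: \<open>dt\<close> and \<open>ds\<close> enter
      only as the numbers p and q of the jet, so f may be arbitrary.\<close>
    using compatibility_eq_0_iff compatibility_eq_1_iff by blast
  fix C :: real
  have "compatibility_solution_on c10 c00 c01 \<Omega> (airy_boundary c10 c00 c01 C)"
    unfolding compatibility_solution_on_def
  proof (intro conjI ballI)
    show "(\<lambda>(t, s). airy_boundary c10 c00 c01 C t s) differentiable_on \<Omega>"
      using assms airy_boundary_differentiable
      by (intro differentiable_at_imp_differentiable_on) fast
    show "case z of (t, s) \<Rightarrow>
        compatibility_eq c10 c00 c01 0 (airy_boundary c10 c00 c01 C) t s \<and>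
        compatibility_eq c10 c00 c01 1 (airy_boundary c10 c00 c01 C) t s" if "z \<in> \<Omega>" for z
      using assms that airy_boundary_equations
      unfolding compatibility_eq_0_iff compatibility_eq_1_iff by blast
  qed
  then show "compatibility_solution_on c10 c00 c01 \<Omega>
      (\<lambda>t s. - (c00 / c01) + C * root 3 (1 - c01 * s)
        + (c10 + c01 * t)\<^sup>2 / (4 * c01 * (1 - c01 * s)))"
    unfolding airy_boundary_def .
qed

end
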